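(* Let $s$ and $l$ be integers with $s\geq l\geq 0$, and let $j$ be an integer. Then \begin{align*} &\sum_{m=0}^{\lfloor (l-1)/2\rfloor}\sum_{i=2m}^{l-1} (-2)^{i-2m}\left\{\binom{s-l}{i-2m,\,j-l+m,\,s-i-j+m} \, \beta_{m}(s,l,i+j-l,l-i)\right.\\ &\qquad\qquad+\left.\binom{s-l}{i-2m,\,j-i+m,\,s-l-j+m} \, \beta_{m}(s,l,l+j-i,i-l)\right\}\\ &\qquad\qquad+\sum_{m=0}^{\lfloor l/2\rfloor}(-2)^{l-2m}\binom{s-l}{l-2m,\,j-l+m,\,s-l-j+m} \, \beta_{m}(s,l,j,0)=\binom{s}{j}, \end{align*} where $\lfloor x\rfloor$ denotes the largest integer $\leq x$. (In particular the left-hand side does not depend on $l$.)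
   Context: Multinomial coefficients: for a positive integer $k$ and integers $r_1,\dots,r_k$ with $n=r_1+\cdots+r_k\geq 0$, $\binom{n}{r_1,\dots,r_k}=\frac{n!}{r_1!\cdots r_k!}$ if all $r_i\geq 0$, and $\binom{n}{r_1,\dots,r_k}=0$ otherwise. Binomial coefficients: for $n\geq 0$ and any integer $r$, $\binom{n}{r}=\binom{n}{r,\,n-r}$ (so it is $0$ if $r<0$ or $r>n$). For an integer $b$ put $b_{+}=\frac{|b|+b}{2}$ and $b_{-}=\frac{|b|-b}{2}$. For integers $a,b,s,l,m$ with $s\geq a\geq 0$ and $s\geq l$, define $$\beta_{m}(s,l,a,b)=\sum_{n=0}^{|b|+m}\binom{s-a}{b_{+}+m-n}\binom{a}{b_{-}+m-n}\binom{s-l+n}{n}$$ (an empty sum is $0$). A product of a vanishing multinomial coefficient with a $\beta$-term is taken to be $0$; whenever the multinomial coefficient in a term is nonzero, the accompanying $\beta$ has arguments satisfying $s\geq a\geq 0$. *)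

theory Defs
  imports Complex_Main
begin

text \<open>
  \<open>multinom n rs\<close> is only meaningful when \<open>n = sum_list rs\<close>. The lower entries are arbitrary
  integers; the coefficient vanishes as soon as one of them is negative. Values are taken in
  \<open>rat\<close> so that the quotient of factorials is an honest division.
\<close>

definition multinom :: "int \<Rightarrow> int list \<Rightarrow> rat" where
  "multinom n rs =
     (if \<forall>r \<in> set rs. r \<ge> 0
      then fact (nat n) / (\<Prod>r\<leftarrow>rs. fact (nat r))
      else 0)"

definition binom :: "int \<Rightarrow> int \<Rightarrow> rat" where
  "binom n r = multinom n [r, n - r]"

text \<open>In the next two definitions the division is exact, since \<open>\<bar>b\<bar> + b\<close> and \<open>\<bar>b\<bar> - b\<close> are even.\<close>

definition pos_part :: "int \<Rightarrow> int" where
  "pos_part b = (\<bar>b\<bar> + b) div 2"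

definition neg_part :: "int \<Rightarrow> int" where
  "neg_part b = (\<bar>b\<bar> - b) div 2"

text \<open>
  The intended domain is \<open>s \<ge> a \<ge> 0\<close> and \<open>s \<ge> l\<close>. Outside of it the value is irrelevant: it only
  ever occurs multiplied by a vanishing multinomial coefficient.
\<close>

definition beta :: "int \<Rightarrow> int \<Rightarrow> int \<Rightarrow> int \<Rightarrow> int \<Rightarrow> rat" where
  "beta m s l a b =
     (\<Sum>n = 0..\<bar>b\<bar> + m.
        binom (s - a) (pos_part b + m - n) * binom a (neg_part b + m - n) * binom (s - l + n) n)"

lemma binom_eq_choose:
  assumes "n \<ge> 0"
  shows "binom n r = (if r < 0 then 0 else of_nat (nat n choose nat r))"
proof (cases "0 \<le> r \<and> r \<le> n")
  case True
  then have "nat r \<le> nat n" "nat (n - r) = nat n - nat r" by auto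
  then show ?thesis
    using True by (simp add: binom_def multinom_def binomial_fact)
next
  case False
  then show ?thesis
    using assms by (auto simp: binom_def multinom_def)
qed

end

theory Submission
  imports Defs "HOL-Computational_Algebra.Formal_Power_Series"
begin

text \<open>
  Put \<open>N = s - l\<close>. Both families of terms and the diagonal one are summands indexed by pairs
  \<open>e, f \<ge> 0\<close> with \<open>e + f \<le> l\<close>: writing \<open>k = l - e - f\<close>, \<open>p = j - l + e\<close> and \<open>q = N - k - p\<close>,
  the summand is \<open>(-2)^k\<close> times the trinomial coefficient of \<open>k, p, q\<close> times
  \<open>\<Sum>n. (k+q+f choose f-n) (k+p+e choose e-n) (N+n choose n)\<close>.
  Summing negative binomial series, the last factor is the coefficient of \<open>X^f Y^e\<close> in
  \<open>(1-X)^p (1-Y)^q / (1-X-Y)^(N+1)\<close>. Hence the whole sum is the coefficient of \<open>X^j Y^(s-j)\<close> in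
  \<open>(X(1-X) + Y(1-Y) - 2XY)^N / (1-X-Y)^(N+1)\<close>. As the base of the numerator factors as
  \<open>(X+Y)(1-X-Y)\<close>, this series is \<open>(X+Y)^N / (1-X-Y)\<close>, whose homogeneous part of degree
  \<open>s \<ge> N\<close> is \<open>(X+Y)^s\<close>.
\<close>

unbundle fps_syntax

section \<open>One-variable series: powers and composition\<close>

text \<open>The series 1/(1-X), over any commutative ring because it is needed both over the
  rationals and over the series in Y.\<close>

definition geo :: "'a::comm_ring_1 fps" where
  "geo = Abs_fps (\<lambda>_. 1)"

lemma geo_inverse: "(1 - fps_X) * geo = (1 :: 'a::comm_ring_1 fps)"
  by (simp add: fps_eq_iff geo_def left_diff_distrib)

text \<open>Multiplying by \<open>geo\<close> takes partial sums, so the induction step is the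
  hockey-stick identity.\<close>

lemma geo_power_nth: "(geo ^ Suc r :: 'a::comm_ring_1 fps) $ n = of_nat (r + n choose n)"
proof (induction r arbitrary: n)
  case 0
  then show ?case by (simp add: geo_def)
next
  case (Suc r)
  have "(geo ^ Suc (Suc r) :: 'a fps) $ n = (geo ^ Suc r * geo) $ n"
    by (simp only: power_Suc2)
  also have "\<dots> = (\<Sum>i\<le>n. of_nat (r + i choose i))"
    by (simp only: fps_mult_nth Suc) (simp add: geo_def atLeast0AtMost)
  also have "\<dots> = of_nat (Suc (r + n) choose n)"
    by (simp only: flip: of_nat_sum sum_choose_lower)
  finally show ?case by simp
qed

text \<open>As \<open>b\<close> has no constant term, \<open>b ^ i\<close> starts in degree i or
  higher; all coefficients up to degree n can thus use the same finite range of i, and the sums can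
  be swapped.\<close>

lemma fps_compose_mult_nth:
  fixes a b c :: "'a::comm_ring_1 fps"
  assumes "b $ 0 = 0"
  shows "((a oo b) * c) $ n = (\<Sum>i\<le>n. a $ i * (b ^ i * c) $ n)"
proof -
  have compose_nth: "(a oo b) $ k = (\<Sum>i\<le>n. a $ i * (b ^ i $ k))" if "k \<le> n" for k
    unfolding fps_compose_nth using that
    by (intro sum.mono_neutral_left) (auto simp: startsby_zero_power_prefix[OF assms])
  have "((a oo b) * c) $ n = (\<Sum>k=0..n. \<Sum>i\<le>n. a $ i * (b ^ i $ k) * c $ (n - k))"
    by (simp add: fps_mult_nth compose_nth sum_distrib_right)
  also have "\<dots> = (\<Sum>i\<le>n. a $ i * (b ^ i * c) $ n)"
    by (subst sum.swap) (simp add: fps_mult_nth sum_distrib_left mult.assoc)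
  finally show ?thesis .
qed

section \<open>Bivariate series and the reciprocal of 1 - X - Y\<close>

text \<open>
  Bivariate series over the rationals: the coefficient of \<open>X^a Y^b\<close> in \<open>F\<close> is \<open>F $ a $ b\<close>.
\<close>

abbreviation X :: "rat fps fps" where "X \<equiv> fps_X"
abbreviation Y :: "rat fps fps" where "Y \<equiv> fps_const fps_X"

text \<open>The series \<open>1/(1-X-Y)\<close>, expanded in \<open>X\<close> over the series in \<open>Y\<close>.\<close>

definition geo2 :: "rat fps fps" where
  "geo2 = Abs_fps (\<lambda>f. geo ^ Suc f)"

lemma geo_Y_inverse: "(1 - Y) * fps_const geo = 1"
proof -
  have "(1 - Y) * fps_const geo = fps_const ((1 - fps_X) * geo)"
    by (simp only: flip: fps_const_mult fps_const_sub fps_const_1_eq_1)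
  then show ?thesis by (simp only: geo_inverse) simp
qed

lemma geo2_inverse: "(1 - X - Y) * geo2 = 1"
proof (rule fps_ext)
  fix n
  \<comment> \<open>Here \<open>fps_X\<close> is the variable Y: the coefficients of X^n in (1-Y)
    \<open>geo2\<close> and X \<open>geo2\<close> agree for n > 0.\<close>
  have step: "geo ^ Suc k - fps_X * geo ^ Suc k = (geo ^ k :: rat fps)" for k
  proof -
    have step: "geo ^ Suc k - fps_X * geo ^ Suc k = ((1 - fps_X) * geo) * (geo ^ k :: rat fps)"
      by (simp add: algebra_simps)
    then show ?thesis by (simp add: geo_inverse)
  qed
  have "((1 - X - Y) * geo2) $ n = (geo2 $ n - fps_X * geo2 $ n) - (X * geo2) $ n"
    by (simp add: left_diff_distrib)
  also have "\<dots> = 1 $ n"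
    by (cases n) (simp_all only: geo2_def fps_nth_Abs_fps step fps_X_mult_nth, simp_all)
  finally show "((1 - X - Y) * geo2) $ n = 1 $ n" .
qed

text \<open>Multiplying by X + Y acts on coefficients by Pascal's rule. The bound reflects that the
  product has no terms of total degree below N.\<close>

lemma X_plus_Y_power_geo2_nth:
  "N \<le> a + b \<Longrightarrow> ((X + Y) ^ N * geo2) $ a $ b = of_nat (a + b choose a)"
proof (induction N arbitrary: a b)
  case 0
  show ?case
    using binomial_symmetric[of a "a + b"] by (simp add: geo2_def geo_power_nth del: power_Suc)
next
  case (Suc N)
  have "(X + Y) ^ Suc N * geo2 = X * ((X + Y) ^ N * geo2) + Y * ((X + Y) ^ N * geo2)"
    by (simp add: algebra_simps)
  moreover define F where "F = (X + Y) ^ N * geo2"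
  ultimately have "((X + Y) ^ Suc N * geo2) $ a $ b =
      (if a = 0 then 0 else F $ (a - 1) $ b) + (if b = 0 then 0 else F $ a $ (b - 1))"
    by simp
  moreover have "F $ a $ b = of_nat (a + b choose a)" if "N \<le> a + b" for a b
    using Suc.IH[OF that] by (simp add: F_def)
  ultimately show ?case
    using Suc.prems by (cases a; cases b) simp_all
qed

section \<open>Generating function of the beta sums\<close>

lemma monomial_mult_nth:
  "(X ^ u * Y ^ v * F) $ a $ b = (if u \<le> a \<and> v \<le> b then F $ (a - u) $ (b - v) else 0)"
  by (simp add: mult.assoc fps_X_power_mult_nth)

text \<open>With z = XY/((1-X)(1-Y)) the series equals (1-X)^-(k+q+1) (1-Y)^-(k+p+1)
  (1-z)^-(k+p+q+1); the index n is the power of z.\<close>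

lemma beta_generating_function:
  fixes k p q e f :: nat
  shows "((1 - X) ^ p * (1 - Y) ^ q * geo2 ^ Suc (k + p + q)) $ f $ e =
    (\<Sum>n\<le>f. of_nat (k + p + q + n choose n) *
       (if n \<le> e then of_nat (k + q + f choose (f - n)) * of_nat (k + p + e choose (e - n)) else 0))"
proof -
  define A :: "rat fps fps" where "A = geo"
  define B :: "rat fps fps" where "B = fps_const geo"
  define N where "N = k + p + q"
  define z where "z = X * Y * A * B"
  define G :: "rat fps fps" where "G = geo ^ Suc N"
  define H where "H = A ^ Suc (k + q) * B ^ Suc (k + p)"
  have A: "(1 - X) * A = 1" and B: "(1 - Y) * B = 1"
    using geo_inverse geo_Y_inverse by (simp_all add: A_def B_def)
  have z0: "z $ 0 = 0"
    by (simp add: z_def mult.assoc)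
  \<comment> \<open>The negative binomial series in \<open>z\<close> is \<open>(1-z)^-(N+1)\<close>, and \<open>1 - z\<close> is \<open>(1-X-Y) / ((1-X)(1-Y))\<close>.\<close>
  have "1 - z = ((1 - X) * A) * ((1 - Y) * B) - z"
    by (simp add: A B)
  also have "\<dots> = A * B * (1 - X - Y)"
    by (simp add: z_def algebra_simps)
  finally have one_minus_z: "(1 - z) * geo2 = A * B"
    using geo2_inverse by (simp add: mult.assoc)
  have "(1 - fps_X) ^ Suc N * G = 1"
    by (simp only: G_def flip: power_mult_distrib) (simp add: geo_inverse)
  then have "((1 - fps_X) ^ Suc N * G) oo z = 1 oo z" by simp
  then have Gz: "(1 - z) ^ Suc N * (G oo z) = 1"
    by (simp only: fps_compose_mult_distrib[OF z0] fps_compose_power[OF z0, symmetric] fps_compose_sub_distrib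
        fps_X_fps_compose_startby0[OF z0] fps_compose_1)
  have "(1 - X) ^ p * (1 - Y) ^ q * geo2 ^ Suc N
      = (1 - X) ^ p * (1 - Y) ^ q * geo2 ^ Suc N * ((1 - z) ^ Suc N * (G oo z))"
    by (simp only: Gz mult_1_right)
  also have "\<dots> = (1 - X) ^ p * (1 - Y) ^ q * ((1 - z) * geo2) ^ Suc N * (G oo z)"
    by (simp only: power_mult_distrib mult_ac)
  \<comment> \<open>\<open>Suc N\<close> is p + (k+q+1) and also q + (k+p+1), so p copies of
    \<open>A\<close> and q copies of \<open>B\<close> cancel and \<open>H\<close> is left.\<close>
  also have "\<dots> = ((1 - X) * A) ^ p * ((1 - Y) * B) ^ q * H * (G oo z)"
    unfolding one_minus_z
    by (simp only: H_def N_def power_add power_mult_distrib power_Suc mult_ac)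
  also have "\<dots> = (G oo z) * H"
    by (simp only: A B power_one mult_1_left mult.commute[of H])
  finally have "(1 - X) ^ p * (1 - Y) ^ q * geo2 ^ Suc N = (G oo z) * H" .
  then have "((1 - X) ^ p * (1 - Y) ^ q * geo2 ^ Suc N) $ f = (\<Sum>n\<le>f. G $ n * (z ^ n * H) $ f)"
    by (simp only: fps_compose_mult_nth[OF z0])
  moreover have "(G $ n * (z ^ n * H) $ f) $ e = of_nat (N + n choose n) *
     (if n \<le> e then of_nat (k + q + f choose (f - n)) * of_nat (k + p + e choose (e - n)) else 0)"
    if "n \<le> f" for n
  proof -
    have "z ^ n * H = X ^ n * Y ^ n * (A ^ Suc (k + q + n) * B ^ Suc (k + p + n))"
      by (simp only: z_def H_def power_mult_distrib power_add power_Suc mult_ac)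
    then have "(z ^ n * H) $ f $ e =
      (if n \<le> e then (A ^ Suc (k + q + n) * B ^ Suc (k + p + n)) $ (f - n) $ (e - n) else 0)"
      using that by (simp only: monomial_mult_nth) simp
    moreover have "(A ^ Suc (k + q + n) * B ^ Suc (k + p + n)) $ (f - n) $ (e - n) =
      of_nat (k + q + f choose (f - n)) * of_nat (k + p + e choose (e - n))" if "n \<le> e"
      using that \<open>n \<le> f\<close>
      by (simp add: A_def B_def geo_power_nth add.assoc fps_of_nat[symmetric] del: power_Suc)
    moreover have "G $ n = fps_const (of_nat (N + n choose n))"
      by (simp only: G_def geo_power_nth fps_of_nat)
    ultimately show ?thesis by simp
  qed
  ultimately show ?thesis
    unfolding N_def[symmetric] by (simp add: fps_sum_nth)
qed

section \<open>Trinomial expansion\<close>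

lemma trinomial_ring:
  fixes a b c :: "'a::comm_ring_1"
  shows "(a + b + c) ^ N = (\<Sum>k\<le>N. \<Sum>p\<le>N - k.
     of_nat (N choose k) * of_nat (N - k choose p) * (a ^ k * b ^ p * c ^ (N - k - p)))"
proof -
  have "(a + (b + c)) ^ N = (\<Sum>k\<le>N. of_nat (N choose k) * a ^ k * (b + c) ^ (N - k))"
    by (rule binomial_ring)
  also have "\<dots> = (\<Sum>k\<le>N. \<Sum>p\<le>N - k.
     of_nat (N choose k) * of_nat (N - k choose p) * (a ^ k * b ^ p * c ^ (N - k - p)))"
    by (simp add: binomial_ring[of b c] sum_distrib_left mult_ac)
  finally show ?thesis by (simp add: add.assoc)
qed

text \<open>k, p and N-k-p count the factors -2XY, X(1-X) and Y(1-Y); hence Y gets the exponent k +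
  (N-k-p) = N-p.\<close>

lemma X_plus_Y_power_geo2_expansion:
  "(X + Y) ^ N * geo2 = (\<Sum>k\<le>N. \<Sum>p\<le>N - k.
     fps_const (fps_const (of_nat (N choose k) * of_nat (N - k choose p) * (-2) ^ k)) *
     (X ^ (k + p) * Y ^ (N - p) * ((1 - X) ^ p * (1 - Y) ^ (N - k - p) * geo2 ^ Suc N)))"
proof -
  have factorization: "(X + Y) * (1 - X - Y) = (-2) * X * Y + X * (1 - X) + Y * (1 - Y)"
    by (simp add: algebra_simps del: fps_const_mult)
  \<comment> \<open>The inserted ones supply \<open>(1 - X - Y) ^ N\<close> for the numerator and
    raise \<open>geo2\<close> to the power \<open>Suc N\<close>.\<close>
  have "(X + Y) ^ N * geo2 = ((X + Y) * ((1 - X - Y) * geo2)) ^ N * geo2"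
    by (simp add: geo2_inverse)
  also have "\<dots> = ((X + Y) * (1 - X - Y)) ^ N * geo2 ^ Suc N"
    by (simp only: power_mult_distrib power_Suc mult_ac)
  also have "\<dots> = ((-2) * X * Y + X * (1 - X) + Y * (1 - Y)) ^ N * geo2 ^ Suc N"
    by (simp only: factorization)
  also have "\<dots> = (\<Sum>k\<le>N. \<Sum>p\<le>N - k.
     fps_const (fps_const (of_nat (N choose k) * of_nat (N - k choose p) * (-2) ^ k)) *
     (X ^ (k + p) * Y ^ (N - p) * ((1 - X) ^ p * (1 - Y) ^ (N - k - p) * geo2 ^ Suc N)))"
    unfolding trinomial_ring sum_distrib_right
  proof (intro sum.cong refl)
    fix k p assume "k \<in> {..N}" "p \<in> {..N - k}"
    then have "N - p = k + (N - k - p)" by auto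
    moreover have "fps_const (fps_const (of_nat (N choose k) * of_nat (N - k choose p) * (-2) ^ k)) =
       (of_nat (N choose k) * of_nat (N - k choose p) * (-2) ^ k :: rat fps fps)"
      by (simp flip: fps_const_mult fps_const_power fps_of_nat fps_const_neg add: numeral_fps_const)
    ultimately show "of_nat (N choose k) * of_nat (N - k choose p) *
         ((- 2 * X * Y) ^ k * (X * (1 - X)) ^ p * (Y * (1 - Y)) ^ (N - k - p)) * geo2 ^ Suc N =
       fps_const (fps_const (of_nat (N choose k) * of_nat (N - k choose p) * (-2) ^ k)) *
       (X ^ (k + p) * Y ^ (N - p) * ((1 - X) ^ p * (1 - Y) ^ (N - k - p) * geo2 ^ Suc N))"
      by (simp only: power_mult_distrib power_add mult_ac)
  qed
  finally show ?thesis .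
qed

section \<open>Summands as coefficients\<close>

text \<open>
  With \<open>e = m\<close>, \<open>f = l - i + m\<close> this is the first family of terms of the theorem, with \<open>e\<close> and
  \<open>f\<close> exchanged the second one, and for \<open>e = f\<close> the terms of the last sum.
\<close>

definition summand :: "int \<Rightarrow> int \<Rightarrow> int \<Rightarrow> int \<Rightarrow> int \<Rightarrow> rat" where
  "summand s l j e f =
     (-2) ^ nat (l - e - f) * multinom (s - l) [l - e - f, j - l + e, s - l - j + f] *
     (\<Sum>n = 0..max e f. binom (s - j + f - e) (f - n) * binom (j - f + e) (e - n) * binom (s - l + n) n)"

lemma summand_eq_0:
  assumes "l < e + f \<or> j - l + e < 0 \<or> s - l - j + f < 0"
  shows "summand s l j e f = 0"
  using assms by (auto simp: summand_def multinom_def)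

lemma multinom_3:
  "multinom (int (k + p + q)) [int k, int p, int q] =
     of_nat (k + p + q choose k) * of_nat (p + q choose p)"
  by (simp add: multinom_def binomial_fact nat_add_distrib add.assoc flip: of_nat_add)

text \<open>Solving k = l-e-f, p = j-l+e, q = s-l-j+f for s, l and j expresses these as sums of
  natural numbers.\<close>

lemma summand_of_nat:
  fixes k p q e f :: nat
  shows "summand (int (k + p + q + k + e + f)) (int (k + e + f)) (int (k + p + f)) (int e) (int f) =
    of_nat (k + p + q choose k) * of_nat (p + q choose p) * (-2) ^ k *
    ((1 - X) ^ p * (1 - Y) ^ q * geo2 ^ Suc (k + p + q)) $ f $ e"
proof -
  let ?g = "\<lambda>n. binom (int (k + q + f)) (int f - n) * binom (int (k + p + e)) (int e - n)
              * binom (int (k + p + q) + n) n"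
  \<comment> \<open>For n > f the lower entry f - n is negative, so these terms vanish.\<close>
  have "(\<Sum>n = 0..max (int e) (int f). ?g n) = (\<Sum>n = 0..int f. ?g n)"
    by (rule sum.mono_neutral_right) (auto simp: binom_eq_choose)
  also have "\<dots> = (\<Sum>n\<le>f. ?g (int n))"
    by (rule sum.reindex_bij_witness[of _ int nat]) auto
  also have "\<dots> = (\<Sum>n\<le>f. of_nat (k + p + q + n choose n) *
       (if n \<le> e then of_nat (k + q + f choose (f - n)) * of_nat (k + p + e choose (e - n)) else 0))"
  proof (rule sum.cong[OF refl])
    fix n assume "n \<in> {..f}"
    then have "n \<le> f" by simp
    then have "binom (int (k + q + f)) (int f - int n) = of_nat (k + q + f choose (f - n))"
      by (subst binom_eq_choose) (auto simp: nat_diff_distrib simp del: of_nat_add)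
    moreover have "binom (int (k + p + e)) (int e - int n)
        = (if n \<le> e then of_nat (k + p + e choose (e - n)) else 0)"
      by (subst binom_eq_choose) (auto simp: nat_diff_distrib simp del: of_nat_add)
    moreover have "binom (int (k + p + q) + int n) (int n) = of_nat (k + p + q + n choose n)"
      unfolding of_nat_add[symmetric] by (subst binom_eq_choose) (auto simp del: of_nat_add)
    ultimately show "?g (int n) = of_nat (k + p + q + n choose n) *
       (if n \<le> e then of_nat (k + q + f choose (f - n)) * of_nat (k + p + e choose (e - n)) else 0)"
      by simp
  qed
  also have "\<dots> = ((1 - X) ^ p * (1 - Y) ^ q * geo2 ^ Suc (k + p + q)) $ f $ e"
    by (rule beta_generating_function[symmetric])
  finally have *: "(\<Sum>n = 0..max (int e) (int f). ?g n) = \<dots>" .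
  let ?s = "int (k + p + q + k + e + f)" and ?l = "int (k + e + f)" and ?j = "int (k + p + f)"
  have args: "?l - int e - int f = int k" "?j - ?l + int e = int p" "int (k + p + q) - ?j + int f = int q"
    "?s - ?l = int (k + p + q)" "?s - ?j + int f - int e = int (k + q + f)"
    "?j - int f + int e = int (k + p + e)"
    by simp_all
  show ?thesis
    unfolding summand_def args * multinom_3 nat_int by (simp only: mult_ac)
qed

lemma sum_summand:
  assumes "s \<ge> l" "l \<ge> 0"
  shows "(\<Sum>(e, f) \<in> {(e, f). 0 \<le> e \<and> 0 \<le> f \<and> e + f \<le> l}. summand s l j e f) = binom s j"
proof (cases "0 \<le> j \<and> j \<le> s")
  case False
  \<comment> \<open>If e + f \<le> l, then j < 0 makes j - l + e negative and j > s makes s - l - j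
    + f negative.\<close>
  have "summand s l j e f = 0" if "0 \<le> e" "0 \<le> f" for e f
    by (rule summand_eq_0) (use that False in linarith)
  then have "(\<Sum>(e, f) \<in> {(e, f). 0 \<le> e \<and> 0 \<le> f \<and> e + f \<le> l}. summand s l j e f) = 0"
    by (intro sum.neutral) auto
  with False assms show ?thesis
    by (auto simp: binom_eq_choose)
next
  case True
  define N J R where "N = nat (s - l)" and "J = nat j" and "R = nat (s - j)"
  have nats: "s = int J + int R" "j = int J" "l = int J + int R - int N" "N \<le> J + R"
    using True assms by (auto simp: N_def J_def R_def)
  define F where "F k p = (1 - X) ^ p * (1 - Y) ^ (N - k - p) * geo2 ^ Suc N" for k p :: nat
  define c :: "nat \<Rightarrow> nat \<Rightarrow> rat" where
    "c k p = of_nat (N choose k) * of_nat (N - k choose p) * (-2) ^ k" for k p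
  let ?P = "Sigma {..N} (\<lambda>k. {..N - k})"
  let ?Q = "{(k, p) \<in> ?P. k + p \<le> J \<and> N - p \<le> R}"
  let ?E = "{(e, f). 0 \<le> e \<and> 0 \<le> f \<and> e + f \<le> l}"
  have "nat s = J + R"
    using nats(1) by simp
  then have "binom s j = of_nat (J + R choose J)"
    using True by (simp add: binom_eq_choose J_def)
  also have "\<dots> = ((X + Y) ^ N * geo2) $ J $ R"
    using nats by (simp add: X_plus_Y_power_geo2_nth)
  also have "\<dots> = (\<Sum>(k, p) \<in> ?P. (fps_const (fps_const (c k p)) * (X ^ (k + p) * Y ^ (N - p) * F k p)) $ J $ R)"
    unfolding X_plus_Y_power_geo2_expansion fps_sum_nth c_def F_def by (rule sum.Sigma) simp_all
  also have "\<dots> = (\<Sum>(k, p) \<in> ?P. if k + p \<le> J \<and> N - p \<le> R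
                     then c k p * F k p $ (J - (k + p)) $ (R - (N - p)) else 0)"
    by (simp only: fps_mult_left_const_nth monomial_mult_nth) (simp add: if_distrib cong: if_cong)
  also have "\<dots> = (\<Sum>(k, p) \<in> ?Q. c k p * F k p $ (J - (k + p)) $ (R - (N - p)))"
    by (intro sum.mono_neutral_cong_right) (auto split: if_splits)
  also have "\<dots> = (\<Sum>(e, f) \<in> {(e, f) \<in> ?E. 0 \<le> j - l + e \<and> 0 \<le> s - l - j + f}. summand s l j e f)"
  \<comment> \<open>e and f are the exponents of Y and X left after removing
    \<open>Y ^ (N - p)\<close> and \<open>X ^ (k + p)\<close>; the inverse reads k and p off the
    multinomial entries.\<close>
  proof (rule sum.reindex_bij_witness[of _ "\<lambda>(e, f). (nat (l - e - f), nat (j - l + e))"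
        "\<lambda>(k, p). (l - j + int p, j - int k - int p)"], goal_cases)
    case (5 z)
    then obtain k p where z: "z = (k, p)" and kp: "k + p \<le> N" "k + p \<le> J" "N - p \<le> R"
      by auto
    define q e f where "q = N - k - p" and "e = R - (N - p)" and "f = J - (k + p)"
    have eqs: "N = k + p + q" "J = k + p + f" "R = k + q + e"
      using kp by (auto simp: q_def e_def f_def)
    have "s = int (k + p + q + k + e + f)" "l = int (k + e + f)" "j = int (k + p + f)"
      "l - j + int p = int e" "j - int k - int p = int f"
      using nats eqs by auto
    then have "summand s l j (l - j + int p) (j - int k - int p) = c k p * F k p $ f $ e"
      by (simp only: summand_of_nat) (simp add: c_def F_def eqs)
    then show ?case
      by (simp add: z e_def f_def)
  qed (use nats in auto)
  also have "\<dots> = (\<Sum>(e, f) \<in> ?E. summand s l j e f)"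
  proof (rule sum.mono_neutral_left)
    show "finite ?E"
      by (rule finite_subset[of _ "{0..l} \<times> {0..l}"]) auto
  qed (auto intro!: summand_eq_0)
  finally show ?thesis by simp
qed

section \<open>From beta terms to summands\<close>

text \<open>For b = l - i or b = i - l, one of its two parts is 0 and the other l - i, so the
  binomials have lower entries f - n and e - n, and |b| + m is \<open>max e f\<close>.\<close>

lemma summand_beta:
  assumes "i \<le> l"
  shows "(-2) ^ nat (i - 2 * m) * (multinom (s - l) [i - 2 * m, j - l + m, s - i - j + m]
                 * beta m s l (i + j - l) (l - i)) = summand s l j m (l - i + m)"
    and "(-2) ^ nat (i - 2 * m) * (multinom (s - l) [i - 2 * m, j - i + m, s - l - j + m]
                 * beta m s l (l + j - i) (i - l)) = summand s l j (l - i + m) m"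
proof -
  have parts: "pos_part (l - i) = l - i" "neg_part (l - i) = 0"
     "pos_part (i - l) = 0" "neg_part (i - l) = l - i"
    using assms by (auto simp: pos_part_def neg_part_def)
  show "(-2) ^ nat (i - 2 * m) * (multinom (s - l) [i - 2 * m, j - l + m, s - i - j + m]
                 * beta m s l (i + j - l) (l - i)) = summand s l j m (l - i + m)"
    using assms unfolding summand_def beta_def parts by (simp add: algebra_simps max_def)
  show "(-2) ^ nat (i - 2 * m) * (multinom (s - l) [i - 2 * m, j - i + m, s - l - j + m]
                 * beta m s l (l + j - i) (i - l)) = summand s l j (l - i + m) m"
    using assms unfolding summand_def beta_def parts by (simp add: algebra_simps max_def)
qed

theorem theorem1p1:
  fixes s l j :: int
  assumes "s \<ge> l" and "l \<ge> 0"
  shows "(\<Sum>m = 0..\<lfloor>of_int (l - 1) / (2::rat)\<rfloor>. \<Sum>i = 2 * m..l - 1.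
            (-2) ^ nat (i - 2 * m) *
              (multinom (s - l) [i - 2 * m, j - l + m, s - i - j + m]
                 * beta m s l (i + j - l) (l - i)
             + multinom (s - l) [i - 2 * m, j - i + m, s - l - j + m]
                 * beta m s l (l + j - i) (i - l)))
       + (\<Sum>m = 0..\<lfloor>of_int l / (2::rat)\<rfloor>.
            (-2) ^ nat (l - 2 * m) *
              multinom (s - l) [l - 2 * m, j - l + m, s - l - j + m]
                * beta m s l j 0)
       = binom s j" (is "?A + ?B = _")
proof -
  let ?E = "{(e, f). 0 \<le> e \<and> 0 \<le> f \<and> e + f \<le> l}"
  let ?S = "\<lambda>(e, f). summand s l j e f"
  let ?I = "Sigma {0..(l - 1) div 2} (\<lambda>m. {2 * m..l - 1})"
  have floor_half: "\<lfloor>of_int z / (2::rat)\<rfloor> = z div 2" for z :: int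
    using floor_divide_of_int_eq[of z 2, where 'a = rat] by simp
  have "?A = (\<Sum>m = 0..(l - 1) div 2. \<Sum>i = 2 * m..l - 1.
                summand s l j m (l - i + m) + summand s l j (l - i + m) m)"
    unfolding floor_half by (intro sum.cong refl) (simp add: distrib_left summand_beta)
  also have "\<dots> = (\<Sum>(m, i) \<in> ?I. summand s l j m (l - i + m))
                  + (\<Sum>(m, i) \<in> ?I. summand s l j (l - i + m) m)"
    by (simp add: sum.Sigma sum.distrib case_prod_beta)
  \<comment> \<open>With e = m and f = l - i + m, the bound i < l becomes e < f and 2m \<le> i
    becomes e + f \<le> l.\<close>
  also have "(\<Sum>(m, i) \<in> ?I. summand s l j m (l - i + m)) = sum ?S {(e, f) \<in> ?E. e < f}"
    by (rule sum.reindex_bij_witness[of _ "\<lambda>(e, f). (e, l - f + e)" "\<lambda>(m, i). (m, l - i + m)"]) auto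
  also have "(\<Sum>(m, i) \<in> ?I. summand s l j (l - i + m) m) = sum ?S {(e, f) \<in> ?E. f < e}"
    by (rule sum.reindex_bij_witness[of _ "\<lambda>(e, f). (f, l - e + f)" "\<lambda>(m, i). (l - i + m, m)"]) auto
  finally have A: "?A = sum ?S {(e, f) \<in> ?E. e < f} + sum ?S {(e, f) \<in> ?E. f < e}" .
  \<comment> \<open>The diagonal terms are the case i = l of the first family.\<close>
  have "?B = (\<Sum>m = 0..l div 2. summand s l j m m)"
    unfolding floor_half
    by (intro sum.cong refl) (use summand_beta(1)[of l l] in \<open>simp add: mult.assoc\<close>)
  also have "\<dots> = sum ?S {(e, f) \<in> ?E. e = f}"
    by (rule sum.reindex_bij_witness[of _ fst "\<lambda>m. (m, m)"]) auto
  finally have B: "?B = sum ?S {(e, f) \<in> ?E. e = f}" .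
  have fin: "finite {(e, f) \<in> ?E. P e f}" for P
    by (rule finite_subset[of _ "{0..l} \<times> {0..l}"]) auto
  let ?L = "{(e, f) \<in> ?E. e < f}" and ?G = "{(e, f) \<in> ?E. f < e}" and ?D = "{(e, f) \<in> ?E. e = f}"
  have "sum ?S ?E = sum ?S (?L \<union> ?G \<union> ?D)"
    by (rule sum.cong) auto
  also have "\<dots> = sum ?S (?L \<union> ?G) + sum ?S ?D"
    by (rule sum.union_disjoint; (intro finite_UnI fin)?) auto
  also have "sum ?S (?L \<union> ?G) = sum ?S ?L + sum ?S ?G"
    by (rule sum.union_disjoint; (intro fin)?) auto
  also have "sum ?S ?L + sum ?S ?G + sum ?S ?D = ?A + ?B"
    by (simp only: A B)
  finally show ?thesis
    using sum_summand[OF assms] by simp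
qed

end
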